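(* Let $\mathbb{C}^\times$ act algebraically on a complex affine variety $X$. Then there exists a finite set $S$ of positive integers such that $X^{\mu_n}=X^{\mathbb{C}^\times}$ whenever $n>1$ is an integer relatively prime to all elements of $S$.
   Context: $\mu_n\subset\mathbb{C}^\times$ denotes the subgroup of $n$-th roots of unity, acting on $X$ by restriction of the $\mathbb{C}^\times$-action. For a closed subgroup $H\subseteq\mathbb{C}^\times$, $X^H$ denotes the fixed locus of $H$ in $X$. *)

theory Defs
  imports "HOL-Algebra.Group_Action" "HOL-Analysis.Finite_Cartesian_Product"
begin

text \<open>
  The complex algebra of functions generated by a set \<open>G\<close> of complex-valued functions.
\<close>

inductive_set generated_algebra :: "('a \<Rightarrow> complex) set \<Rightarrow> ('a \<Rightarrow> complex) set"
  for G :: "('a \<Rightarrow> complex) set" where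
  gen:   "g \<in> G \<Longrightarrow> g \<in> generated_algebra G"
| const: "(\<lambda>_. c) \<in> generated_algebra G"
| add:   "f \<in> generated_algebra G \<Longrightarrow> g \<in> generated_algebra G
            \<Longrightarrow> (\<lambda>x. f x + g x) \<in> generated_algebra G"
| mult:  "f \<in> generated_algebra G \<Longrightarrow> g \<in> generated_algebra G
            \<Longrightarrow> (\<lambda>x. f x * g x) \<in> generated_algebra G"

definition polynomial_functions :: "(complex ^ 'n \<Rightarrow> complex) set" where
  "polynomial_functions = generated_algebra (range (\<lambda>i x. x $ i))"

text \<open>
  Affine varieties are Zariski closed subsets of an affine space, identified with their sets of
  complex points; irreducibility is not part of the notion.
\<close>

definition affine_variety :: "(complex ^ 'n) set \<Rightarrow> bool" where
  "affine_variety X \<longleftrightarrow> (\<exists>F \<subseteq> polynomial_functions. X = {x. \<forall>f\<in>F. f x = 0})"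

definition complex_units :: "complex monoid" where
  "complex_units = \<lparr>carrier = UNIV - {0}, mult = (*), one = 1\<rparr>"

text \<open>
  The coordinate ring of \<open>\<complex>\<^sup>\<times>\<close> is \<open>\<complex>[t, t\<^sup>-\<^sup>1]\<close>, so the regular functions on the affine variety
  \<open>\<complex>\<^sup>\<times> \<times> X\<close>, for \<open>X\<close> closed in affine space, are the restrictions to \<open>\<complex>\<^sup>\<times> \<times> X\<close> of the
  polynomials in \<open>t\<close>, \<open>t\<^sup>-\<^sup>1\<close> and the coordinates of \<open>x\<close>.
\<close>

definition units_times_affine_functions :: "(complex \<times> (complex ^ 'n) \<Rightarrow> complex) set" where
  "units_times_affine_functions =
     generated_algebra ({\<lambda>(t, x). t, \<lambda>(t, x). inverse t} \<union> range (\<lambda>i (t, x). x $ i))"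

text \<open>
  An algebraic action is a group action whose action map \<open>\<complex>\<^sup>\<times> \<times> X \<rightarrow> X\<close> is a morphism
  of varieties, i.e. has regular coordinate functions.
\<close>

definition algebraic_units_action ::
    "(complex ^ 'n) set \<Rightarrow> (complex \<Rightarrow> complex ^ 'n \<Rightarrow> complex ^ 'n) \<Rightarrow> bool" where
  "algebraic_units_action X \<phi> \<longleftrightarrow>
     group_action complex_units X \<phi> \<and>
     (\<forall>i. \<exists>f \<in> units_times_affine_functions.
        \<forall>t \<in> carrier complex_units. \<forall>x \<in> X. \<phi> t x $ i = f (t, x))"

definition fixed_locus :: "'b set \<Rightarrow> ('a \<Rightarrow> 'b \<Rightarrow> 'b) \<Rightarrow> 'a set \<Rightarrow> 'b set" where
  "fixed_locus X \<phi> H = {x \<in> X. \<forall>h \<in> H. \<phi> h x = x}"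

definition roots_of_unity :: "nat \<Rightarrow> complex set" where
  "roots_of_unity n = {z. z ^ n = 1}"

lemma group_complex_units: "group complex_units"
  by (rule groupI) (auto simp: complex_units_def intro!: bexI[of _ "inverse _"])

lemma subgroup_roots_of_unity:
  assumes "n > 0"
  shows "subgroup (roots_of_unity n) complex_units"
proof (rule group.subgroupI[OF group_complex_units])
  show "roots_of_unity n \<subseteq> carrier complex_units"
    using assms by (auto simp: roots_of_unity_def complex_units_def power_0_left)
  show "roots_of_unity n \<noteq> {}"
    by (auto simp: roots_of_unity_def intro: exI[of _ 1])
next
  fix a assume a: "a \<in> roots_of_unity n"
  then have "a \<noteq> 0"
    using assms by (auto simp: roots_of_unity_def power_0_left)
  then have "inv\<^bsub>complex_units\<^esub> a = inverse a"
    by (intro group.inv_equality[OF group_complex_units]) (auto simp: complex_units_def)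
  then show "inv\<^bsub>complex_units\<^esub> a \<in> roots_of_unity n"
    using a by (simp add: roots_of_unity_def power_inverse)
next
  fix a b assume "a \<in> roots_of_unity n" "b \<in> roots_of_unity n"
  then show "a \<otimes>\<^bsub>complex_units\<^esub> b \<in> roots_of_unity n"
    by (simp add: roots_of_unity_def complex_units_def power_mult_distrib)
qed

end

theory Submission
  imports Defs "HOL-Computational_Algebra.Polynomial"
begin

text \<open>
  For a point \<open>x\<close> of \<open>X\<close>, every coordinate of the orbit map \<open>t \<mapsto> \<phi> t x\<close> is a Laurent polynomial
  in \<open>t\<close>. Regularity of the action bounds its exponents between \<open>-N\<close> and \<open>N\<close> with \<open>N\<close> independent
  of \<open>x\<close> (\<open>units_times_affine_functions_clear_denominator\<close>), and since there are finitely many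
  coordinates, one \<open>N\<close> serves them all. If \<open>\<mu>\<^sub>n\<close> fixes \<open>x\<close>, the \<open>i\<close>-th Laurent polynomial takes the
  value \<open>x $ i\<close> at \<open>n\<close> distinct points, so for \<open>n > 2 * N\<close> it is constant
  (\<open>laurent_constant_on_roots_of_unity\<close>), and \<open>x\<close> is fixed by all of \<open>\<complex>\<^sup>\<times>\<close>.

  It remains to encode largeness of \<open>n\<close> as a coprimality condition: an integer \<open>n > 1\<close> that is
  coprime to each of \<open>1, \<dots>, 2 * N\<close> cannot be one of these numbers, since it is not coprime to
  itself.
\<close>

text \<open>
  Multiplication by \<open>t ^ N\<close> clears the negative powers of \<open>t\<close>. The order of the quantifiers is
  essential: \<open>N\<close> is chosen before \<open>x\<close>. A single number bounds both the pole order and the degree,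
  because then the bounds of two functions simply add up under sums and products alike.
\<close>

lemma units_times_affine_functions_clear_denominator:
  assumes "f \<in> units_times_affine_functions"
  shows "\<exists>N. \<forall>x. \<exists>p. degree p \<le> 2 * N \<and> (\<forall>t. t \<noteq> 0 \<longrightarrow> t ^ N * f (t, x) = poly p t)"
  using assms unfolding units_times_affine_functions_def
proof (induction rule: generated_algebra.induct)
  case (gen g)
  then consider "g = (\<lambda>(t, x). t)" | "g = (\<lambda>(t, x). inverse t)" | i where "g = (\<lambda>(t, x). x $ i)"
    by auto
  then show ?case
  proof cases
    case 1
    then show ?thesis
      by (intro exI[of _ 1] allI exI[of _ "monom 1 2"])
         (simp add: degree_monom_eq poly_monom power2_eq_square)
  next
    case 2
    then show ?thesis
      by (intro exI[of _ 1] allI exI[of _ 1]) simp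
  next
    case (3 i)
    show ?thesis
    proof (rule exI[of _ 0], rule allI)
      fix x
      show "\<exists>p. degree p \<le> 2 * 0 \<and> (\<forall>t. t \<noteq> 0 \<longrightarrow> t ^ 0 * g (t, x) = poly p t)"
        using 3 by (intro exI[of _ "[:x $ i:]"]) simp
    qed
  qed
next
  case (const c)
  show ?case
    by (intro exI[of _ 0] allI exI[of _ "[:c:]"]) simp
next
  case (add f g)
  from add.IH obtain M N where
    M: "\<forall>x. \<exists>p. degree p \<le> 2 * M \<and> (\<forall>t. t \<noteq> 0 \<longrightarrow> t ^ M * f (t, x) = poly p t)" and
    N: "\<forall>x. \<exists>q. degree q \<le> 2 * N \<and> (\<forall>t. t \<noteq> 0 \<longrightarrow> t ^ N * g (t, x) = poly q t)"
    by blast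
  show ?case
  proof (intro exI[of _ "M + N"] allI)
    fix x
    obtain p where p: "degree p \<le> 2 * M" "\<And>t. t \<noteq> 0 \<Longrightarrow> t ^ M * f (t, x) = poly p t"
      using M by blast
    obtain q where q: "degree q \<le> 2 * N" "\<And>t. t \<noteq> 0 \<Longrightarrow> t ^ N * g (t, x) = poly q t"
      using N by blast
    let ?r = "monom 1 N * p + monom 1 M * q"
    have "degree (monom 1 N * p) \<le> 2 * (M + N)"
      using degree_mult_le[of "monom 1 N" p] degree_monom_le[of "1 :: complex" N] p(1)
      by (simp add: algebra_simps)
    moreover have "degree (monom 1 M * q) \<le> 2 * (M + N)"
      using degree_mult_le[of "monom 1 M" q] degree_monom_le[of "1 :: complex" M] q(1)
      by (simp add: algebra_simps)
    ultimately have "degree ?r \<le> 2 * (M + N)"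
      by (rule degree_add_le)
    moreover have "t ^ (M + N) * (f (t, x) + g (t, x)) = poly ?r t" if "t \<noteq> 0" for t
      using p(2)[OF that, symmetric] q(2)[OF that, symmetric]
      by (simp add: poly_monom power_add algebra_simps)
    ultimately show "\<exists>r. degree r \<le> 2 * (M + N) \<and>
        (\<forall>t. t \<noteq> 0 \<longrightarrow> t ^ (M + N) * (f (t, x) + g (t, x)) = poly r t)"
      by blast
  qed
next
  case (mult f g)
  from mult.IH obtain M N where
    M: "\<forall>x. \<exists>p. degree p \<le> 2 * M \<and> (\<forall>t. t \<noteq> 0 \<longrightarrow> t ^ M * f (t, x) = poly p t)" and
    N: "\<forall>x. \<exists>q. degree q \<le> 2 * N \<and> (\<forall>t. t \<noteq> 0 \<longrightarrow> t ^ N * g (t, x) = poly q t)"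
    by blast
  show ?case
  proof (intro exI[of _ "M + N"] allI)
    fix x
    obtain p where p: "degree p \<le> 2 * M" "\<And>t. t \<noteq> 0 \<Longrightarrow> t ^ M * f (t, x) = poly p t"
      using M by blast
    obtain q where q: "degree q \<le> 2 * N" "\<And>t. t \<noteq> 0 \<Longrightarrow> t ^ N * g (t, x) = poly q t"
      using N by blast
    have "degree (p * q) \<le> 2 * (M + N)"
      using degree_mult_le[of p q] p(1) q(1) by simp
    moreover have "t ^ (M + N) * (f (t, x) * g (t, x)) = poly (p * q) t" if "t \<noteq> 0" for t
      using p(2)[OF that, symmetric] q(2)[OF that, symmetric]
      by (simp add: power_add algebra_simps)
    ultimately show "\<exists>r. degree r \<le> 2 * (M + N) \<and>
        (\<forall>t. t \<noteq> 0 \<longrightarrow> t ^ (M + N) * (f (t, x) * g (t, x)) = poly r t)"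
      by blast
  qed
qed

text \<open>
  The polynomials \<open>p\<close> and \<open>c * t ^ N\<close> both have degree at most \<open>2 * N\<close> and agree at the \<open>n > 2 * N\<close>
  roots of unity, so they coincide.
\<close>

lemma laurent_constant_on_roots_of_unity:
  fixes h :: "complex \<Rightarrow> complex"
  assumes deg: "degree p \<le> 2 * N" and h: "\<And>t. t \<noteq> 0 \<Longrightarrow> t ^ N * h t = poly p t"
    and n: "2 * N < n" and const: "\<And>t. t \<in> roots_of_unity n \<Longrightarrow> h t = c"
    and t: "t \<noteq> 0"
  shows "h t = c"
proof -
  have card: "card (roots_of_unity n) = n"
    using n card_roots_unity_eq[of n] by (simp add: roots_of_unity_def)
  have "p = monom c N"
  proof (rule poly_eqI_degree)
    fix z assume z: "z \<in> roots_of_unity n"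
    then have "z \<noteq> 0"
      using n by (auto simp: roots_of_unity_def power_0_left)
    then show "poly p z = poly (monom c N) z"
      using h[of z] const[OF z] by (simp add: poly_monom mult.commute)
  next
    show "card (roots_of_unity n) > degree p"
      using card deg n by simp
    show "card (roots_of_unity n) > degree (monom c N)"
      using card degree_monom_le[of c N] n by linarith
  qed
  then show ?thesis
    using h[OF t] t by (simp add: poly_monom mult.commute)
qed

theorem proposition2p2:
  fixes X :: "(complex ^ 'n) set"
    and \<phi> :: "complex \<Rightarrow> complex ^ 'n \<Rightarrow> complex ^ 'n"
  assumes "affine_variety X"
    and "algebraic_units_action X \<phi>"
  shows "\<exists>S :: nat set. finite S \<and> (\<forall>s\<in>S. s > 0) \<and>
           (\<forall>n > 1. (\<forall>s\<in>S. coprime n s) \<longrightarrow>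
              fixed_locus X \<phi> (roots_of_unity n) = fixed_locus X \<phi> (carrier complex_units))"
proof -
  have units: "carrier complex_units = UNIV - {0}"
    by (simp add: complex_units_def)
  obtain f where f: "\<And>i. f i \<in> units_times_affine_functions"
    and \<phi>: "\<And>i t x. t \<noteq> 0 \<Longrightarrow> x \<in> X \<Longrightarrow> \<phi> t x $ i = f i (t, x)"
    using assms(2) unfolding algebraic_units_action_def units by (metis DiffI UNIV_I singletonD)
  obtain N where N: "\<And>i x. \<exists>p. degree p \<le> 2 * N i \<and>
      (\<forall>t. t \<noteq> 0 \<longrightarrow> t ^ N i * f i (t, x) = poly p t)"
    using units_times_affine_functions_clear_denominator[OF f] by metis
  define B where "B = 2 * Max (range N)"
  have N_le_B: "2 * N i \<le> B" for i
    by (simp add: B_def)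
  have "fixed_locus X \<phi> (roots_of_unity n) = fixed_locus X \<phi> (carrier complex_units)"
    if n: "n > 1" "\<forall>s\<in>{1..B}. coprime n s" for n
  proof
    have "n \<notin> {1..B}"
      using n(1) n(2)[rule_format, of n] by auto
    then have "B < n"
      using n(1) by simp
    show "fixed_locus X \<phi> (roots_of_unity n) \<subseteq> fixed_locus X \<phi> (carrier complex_units)"
    proof
      fix x assume "x \<in> fixed_locus X \<phi> (roots_of_unity n)"
      then have x: "x \<in> X" and fixed: "\<And>z. z \<in> roots_of_unity n \<Longrightarrow> \<phi> z x = x"
        by (auto simp: fixed_locus_def)
      have "\<phi> t x $ i = x $ i" if "t \<noteq> 0" for t i
      proof -
        obtain p where p: "degree p \<le> 2 * N i"
          "\<And>t. t \<noteq> 0 \<Longrightarrow> t ^ N i * f i (t, x) = poly p t"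
          using N[of i x] by blast
        show ?thesis
        proof (rule laurent_constant_on_roots_of_unity[where h = "\<lambda>t. \<phi> t x $ i", OF p(1)])
          show "t ^ N i * \<phi> t x $ i = poly p t" if "t \<noteq> 0" for t
            using p(2) \<phi> x that by simp
          show "2 * N i < n"
            using N_le_B[of i] \<open>B < n\<close> by simp
        qed (use fixed that in auto)
      qed
      then show "x \<in> fixed_locus X \<phi> (carrier complex_units)"
        using x by (simp add: fixed_locus_def units vec_eq_iff)
    qed
    show "fixed_locus X \<phi> (carrier complex_units) \<subseteq> fixed_locus X \<phi> (roots_of_unity n)"
      using subgroup.subset[OF subgroup_roots_of_unity[of n]] n(1)
      by (auto simp: fixed_locus_def)
  qed
  then show ?thesis
    by (intro exI[of _ "{1..B}"]) auto
qed

end
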